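(* Let $X,Y$ be any sets and let $F:X\times Y\to X$ be a mapping such that for each fixed $\mathbf{q}\in X$ the map $F(\mathbf{q},\cdot):Y\to X$ is bijective. Then there exists a unique mapping $S:X\times Y\to X\times Y$ such that $\Pi_1\circ S=F$ and $S\circ S=I$, and it is given by $$S(\mathbf{q},\mathbf{v})=\bigl(F(\mathbf{q},\mathbf{v}),\,F(F(\mathbf{q},\mathbf{v}),\cdot)^{-1}(\mathbf{q})\bigr)\qquad\text{for all }(\mathbf{q},\mathbf{v})\in X\times Y.$$
   Context: $\Pi_1:X\times Y\to X$ is the projection $\Pi_1(\mathbf{q},\mathbf{v})=\mathbf{q}$, and for $\mathbf{q}\in X$, $F(\mathbf{q},\cdot)^{-1}:X\to Y$ denotes the inverse of the map $\mathbf{v}\mapsto F(\mathbf{q},\mathbf{v})$. *)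

theory Defs
  imports Main "HOL-Library.FuncSet"
begin

end

theory Submission
  imports Defs
begin

text \<open>Write S(q, v) = (q', w). The first condition forces q' = F(q, v); applying it again at
  (q', w) and using that S is an involution gives F(q', w) = q, which determines w because
  F(q', .) is injective. Conversely, with w so chosen, the relations F(q, v) = q' and
  F(q', w) = q are exchanged by swapping (q, v) with (q', w), so S is an involution.\<close>

theorem proposition3p3:
  fixes X :: "'a set" and Y :: "'b set" and F :: "'a \<times> 'b \<Rightarrow> 'a"
  assumes "F \<in> X \<times> Y \<rightarrow> X"
    and "\<forall>q\<in>X. bij_betw (\<lambda>v. F (q, v)) Y X"
  shows "(\<exists>!S. S \<in> X \<times> Y \<rightarrow>\<^sub>E X \<times> Y
              \<and> (\<forall>p\<in>X \<times> Y. (fst \<circ> S) p = F p)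
              \<and> (\<forall>p\<in>X \<times> Y. (S \<circ> S) p = p))
       \<and> (\<forall>S. S \<in> X \<times> Y \<rightarrow>\<^sub>E X \<times> Y
              \<and> (\<forall>p\<in>X \<times> Y. (fst \<circ> S) p = F p)
              \<and> (\<forall>p\<in>X \<times> Y. (S \<circ> S) p = p)
            \<longrightarrow> (\<forall>q\<in>X. \<forall>v\<in>Y.
                  S (q, v) = (F (q, v), inv_into Y (\<lambda>w. F (F (q, v), w)) q)))"
proof -
  let ?P = "\<lambda>S. S \<in> X \<times> Y \<rightarrow>\<^sub>E X \<times> Y
              \<and> (\<forall>p\<in>X \<times> Y. (fst \<circ> S) p = F p)
              \<and> (\<forall>p\<in>X \<times> Y. (S \<circ> S) p = p)"
  \<comment> \<open>The inverse of \<open>F (q, .)\<close> stays folded until the end; only its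
    range and the two cancellation laws \<open>F_G\<close> and \<open>G_F\<close> are used.\<close>
  define G where "G q = inv_into Y (\<lambda>w. F (q, w))" for q
  have F_in: "F (q, v) \<in> X" if "q \<in> X" "v \<in> Y" for q v
    using assms(1) that by auto
  have G_in: "G q x \<in> Y" and F_G: "F (q, G q x) = x" if "q \<in> X" "x \<in> X" for q x
  proof -
    from assms(2) that have bij: "bij_betw (\<lambda>v. F (q, v)) Y X" by blast
    then have "x \<in> (\<lambda>v. F (q, v)) ` Y"
      using that by (simp add: bij_betw_def)
    then show "G q x \<in> Y"
      unfolding G_def by (rule inv_into_into)
    from bij \<open>x \<in> X\<close> show "F (q, G q x) = x"
      unfolding G_def by (rule bij_betw_inv_into_right)
  qed
  have G_F: "G q (F (q, v)) = v" if "q \<in> X" "v \<in> Y" for q v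
  proof -
    from assms(2) that have "bij_betw (\<lambda>v. F (q, v)) Y X" by blast
    from bij_betw_inv_into_left[OF this \<open>v \<in> Y\<close>] show ?thesis
      unfolding G_def .
  qed
  \<comment> \<open>Proved for an arbitrary solution, since it yields both uniqueness and the second
    conjunct of the goal.\<close>
  have formula: "S (q, v) = (F (q, v), G (F (q, v)) q)"
    if "?P S" "q \<in> X" "v \<in> Y" for S q v
  proof -
    obtain q' w where S: "S (q, v) = (q', w)" by fastforce
    have "(q', w) \<in> X \<times> Y"
      using PiE_mem[of S "X \<times> Y" "\<lambda>_. X \<times> Y" "(q, v)"] that S by auto
    then have mem: "q' \<in> X" "w \<in> Y" by auto
    have q': "q' = F (q, v)"
      using that S by (metis SigmaI comp_apply fst_conv)
    have "S (q', w) = (q, v)"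
      using that S by (metis SigmaI comp_apply)
    then have "F (q', w) = q"
      using that mem by (metis SigmaI comp_apply fst_conv)
    with G_F[OF mem] S q' show ?thesis by simp
  qed
  \<comment> \<open>The restricted abstraction makes \<open>T\<close> \<open>undefined\<close> off
    \<open>X \<times> Y\<close>, as membership in the extensional function space demands.\<close>
  define T where "T = (\<lambda>(q, v)\<in>X \<times> Y. (F (q, v), G (F (q, v)) q))"
  have T: "?P T"
    \<comment> \<open>With q' = F(q, v) and w = G q' q, \<open>F_G\<close> gives F(q', w) = q; then
      the second component of T(q', w) is G q q' = v by \<open>G_F\<close>.\<close>
    by (auto simp: T_def F_in G_in F_G G_F)
  have "\<exists>!S. ?P S"
  proof (rule ex1I[of ?P, OF T])
    fix S assume S: "?P S"
    have "S p = T p" if "p \<in> X \<times> Y" for p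
      using that formula[OF S] formula[OF T] by (cases p) simp
    \<comment> \<open>Agreement on \<open>X \<times> Y\<close> suffices because both maps are
      extensional.\<close>
    with S T show "S = T" by (blast intro: PiE_ext[where k = "X \<times> Y" and s = "\<lambda>_. X \<times> Y"])
  qed
  with formula show ?thesis
    unfolding G_def by blast
qed

end
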